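(* Let $a,b\in\mathbb{R}$ with $b-a$ a positive integer, let $\alpha\in(0,1/2)$, and let $p,q,r$ be real-valued functions on $\mathbb{N}_{a,b-1}$ with $p(t)\ne0$ and $r(t)>0$ for all $t\in\mathbb{N}_{a,b-1}$. Let $c_1,c_2,d_1,d_2\in\mathbb{R}$ with $c_1^2+c_2^2\ne0$ and $d_1^2+d_2^2\neq0$. Consider the nabla discrete fractional Sturm--Liouville problem $${}^{ABC}_{a}\nabla^\alpha\big(p(t)\,{}^{ABR}\nabla^\alpha_b x(t)\big)+q(t)x(t)=\lambda r(t)x(t),\qquad t\in\mathbb{N}_{a+1,b-1},$$ $$c_1\,\mathbf{E}^1_{\overline{\alpha,1},\frac{-\alpha}{1-\alpha},b^-}x(a)+c_2\,{}^{ABR}\nabla_b^\alpha x(a)=0,$$ $$d_1\,\mathbf{E}^1_{\overline{\alpha,1},\frac{-\alpha}{1-\alpha},b^-}x(b-1)+d_2\,{}^{ABR}\nabla_b^\alpha x(b-1)=0.$$ Eigenfunctions corresponding to distinct eigenvalues of this problem are orthogonal with respect to the weight function $r$: if $\lambda_1\neq\lambda_2$ are eigenvalues with corresponding eigenfunctions $x_{\lambda_1},x_{\lambda_2}$, then $$\sum_{t=a+1}^{b-1}r(t)\,x_{\lambda_1}(t)\,x_{\lambda_2}(t)=0.$$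
   Context: Notation: $\mathbb{N}_{c,d}=\{c,c+1,\dots,d\}$ (empty if $d<c$); $\rho(t)=t-1$; $\nabla f(t)=f(t)-f(t-1)$, $\Delta f(t)=f(t+1)-f(t)$; empty sums are $0$. The rising function is $t^{\overline{\gamma}}=\Gamma(t+\gamma)/\Gamma(t)$. For $|\lambda|<1$ the nabla discrete Mittag-Leffler function is $E_{\overline{\alpha}}(\lambda,z)=\sum_{k=0}^\infty\lambda^k\frac{z^{\overline{k\alpha}}}{\Gamma(\alpha k+1)}$ (here used only for positive integers $z$). $B(\alpha)>0$ is a normalization constant. Define $$\mathbf{E}^1_{\overline{\alpha,1},\frac{-\alpha}{1-\alpha},b^-}f(t)=\sum_{s=t}^{b-1}E_{\overline{\alpha}}\Big(\tfrac{-\alpha}{1-\alpha},s-\rho(t)\Big)f(s),$$ the right ABR fractional difference $${}^{ABR}\nabla_b^\alpha f(t)=-\frac{B(\alpha)}{1-\alpha}\Delta_t\sum_{s=t}^{b-1} f(s)E_{\overline{\alpha}}\Big(\tfrac{-\alpha}{1-\alpha},s-\rho(t)\Big),\quad t\in\{\dots,b-2,b-1\},$$ and the left ABC (Caputo type) fractional difference $${}^{ABC}_{a}\nabla^\alpha f(t)=\frac{B(\alpha)}{1-\alpha}\sum_{s=a+1}^t \nabla f(s)\,E_{\overline{\alpha}}\Big(\tfrac{-\alpha}{1-\alpha},t-\rho(s)\Big),\quad t\in\{a+1,a+2,\dots\}.$$ An eigenvalue is a $\lambda\in\mathbb{C}$ for which the problem (equation and both boundary conditions) has a nontrivial solution $x:\mathbb{N}_{a,b-1}\to\mathbb{C}$,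 called an eigenfunction corresponding to $\lambda$; nontrivial means not identically zero on $\mathbb{N}_{a+1,b-1}$. *)

theory Defs
  imports "HOL-Analysis.Analysis"
begin

text \<open>Functions on a discrete interval are represented by total functions on the reals; the operators
  below only inspect their values at points of the relevant discrete interval.\<close>

definition discrete_interval :: "real \<Rightarrow> real \<Rightarrow> real set" where
  "discrete_interval c d = {c + real k |k. c + real k \<le> d}"

definition rho :: "real \<Rightarrow> real" where
  "rho t = t - 1"

definition nabla_diff :: "(real \<Rightarrow> complex) \<Rightarrow> real \<Rightarrow> complex" where
  "nabla_diff f t = f t - f (t - 1)"

definition delta_diff :: "(real \<Rightarrow> complex) \<Rightarrow> real \<Rightarrow> complex" where
  "delta_diff f t = f (t + 1) - f t"

definition rising :: "real \<Rightarrow> real \<Rightarrow> real" where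
  "rising t \<gamma> = Gamma (t + \<gamma>) / Gamma t"

text \<open>The series is only used for \<open>\<bar>l\<bar> < 1\<close> and positive integers \<open>z\<close>, where it converges: its
  \<open>k\<close>-th term is \<open>l ^ k\<close> times a polynomial in \<open>k\<close>.\<close>

definition nabla_mittag_leffler :: "real \<Rightarrow> real \<Rightarrow> real \<Rightarrow> real" where
  "nabla_mittag_leffler \<alpha> l z =
     (\<Sum>k. l ^ k * (rising z (real k * \<alpha>) / Gamma (\<alpha> * real k + 1)))"

definition right_E1 :: "real \<Rightarrow> real \<Rightarrow> (real \<Rightarrow> complex) \<Rightarrow> real \<Rightarrow> complex" where
  "right_E1 \<alpha> b f t =
     (\<Sum>s\<in>discrete_interval t (b - 1).
        of_real (nabla_mittag_leffler \<alpha> (- \<alpha> / (1 - \<alpha>)) (s - rho t)) * f s)"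

definition right_ABR ::
    "(real \<Rightarrow> real) \<Rightarrow> real \<Rightarrow> real \<Rightarrow> (real \<Rightarrow> complex) \<Rightarrow> real \<Rightarrow> complex" where
  "right_ABR B \<alpha> b f t =
     - of_real (B \<alpha> / (1 - \<alpha>)) *
       delta_diff (\<lambda>u. \<Sum>s\<in>discrete_interval u (b - 1).
         f s * of_real (nabla_mittag_leffler \<alpha> (- \<alpha> / (1 - \<alpha>)) (s - rho u))) t"

definition left_ABC ::
    "(real \<Rightarrow> real) \<Rightarrow> real \<Rightarrow> real \<Rightarrow> (real \<Rightarrow> complex) \<Rightarrow> real \<Rightarrow> complex" where
  "left_ABC B \<alpha> a f t =
     of_real (B \<alpha> / (1 - \<alpha>)) *
       (\<Sum>s\<in>discrete_interval (a + 1) t.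
         nabla_diff f s * of_real (nabla_mittag_leffler \<alpha> (- \<alpha> / (1 - \<alpha>)) (t - rho s)))"

definition SL_solution ::
    "(real \<Rightarrow> real) \<Rightarrow> real \<Rightarrow> real \<Rightarrow> real \<Rightarrow>
     (real \<Rightarrow> real) \<Rightarrow> (real \<Rightarrow> real) \<Rightarrow> (real \<Rightarrow> real) \<Rightarrow>
     real \<Rightarrow> real \<Rightarrow> real \<Rightarrow> real \<Rightarrow> complex \<Rightarrow> (real \<Rightarrow> complex) \<Rightarrow> bool" where
  "SL_solution B \<alpha> a b p q r c1 c2 d1 d2 l x \<longleftrightarrow>
     (\<forall>t\<in>discrete_interval (a + 1) (b - 1).
        left_ABC B \<alpha> a (\<lambda>s. of_real (p s) * right_ABR B \<alpha> b x s) t + of_real (q t) * x t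
          = l * of_real (r t) * x t) \<and>
     of_real c1 * right_E1 \<alpha> b x a + of_real c2 * right_ABR B \<alpha> b x a = 0 \<and>
     of_real d1 * right_E1 \<alpha> b x (b - 1) + of_real d2 * right_ABR B \<alpha> b x (b - 1) = 0"

definition SL_eigenfunction ::
    "(real \<Rightarrow> real) \<Rightarrow> real \<Rightarrow> real \<Rightarrow> real \<Rightarrow>
     (real \<Rightarrow> real) \<Rightarrow> (real \<Rightarrow> real) \<Rightarrow> (real \<Rightarrow> real) \<Rightarrow>
     real \<Rightarrow> real \<Rightarrow> real \<Rightarrow> real \<Rightarrow> complex \<Rightarrow> (real \<Rightarrow> complex) \<Rightarrow> bool" where
  "SL_eigenfunction B \<alpha> a b p q r c1 c2 d1 d2 l x \<longleftrightarrow>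
     SL_solution B \<alpha> a b p q r c1 c2 d1 d2 l x \<and>
     (\<exists>t\<in>discrete_interval (a + 1) (b - 1). x t \<noteq> 0)"

definition SL_eigenvalue ::
    "(real \<Rightarrow> real) \<Rightarrow> real \<Rightarrow> real \<Rightarrow> real \<Rightarrow>
     (real \<Rightarrow> real) \<Rightarrow> (real \<Rightarrow> real) \<Rightarrow> (real \<Rightarrow> real) \<Rightarrow>
     real \<Rightarrow> real \<Rightarrow> real \<Rightarrow> real \<Rightarrow> complex \<Rightarrow> bool" where
  "SL_eigenvalue B \<alpha> a b p q r c1 c2 d1 d2 l \<longleftrightarrow>
     (\<exists>x. SL_eigenfunction B \<alpha> a b p q r c1 c2 d1 d2 l x)"

end

theory Submission
  imports Defs
begin

text \<open>Exchanging the order of summation shows that the left operator is adjoint to the right kernel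
  sum. As the right fractional difference is, up to a constant, the difference of that kernel sum,
  summation by parts turns \<open>\<Sum> (L x) z\<close> for the fractional part \<open>L\<close> of the Sturm--Liouville operator
  into a symmetric bilinear form in \<open>x, z\<close> plus boundary terms. The difference of the boundary terms
  for \<open>(x, z)\<close> and \<open>(z, x)\<close> consists of two determinants, one at each end point, each of which
  vanishes because its rows solve the same nontrivial linear boundary condition.\<close>

text \<open>Moves sums to natural-number indices, where induction and exchanging sums are available.
  For \<open>n < i\<close> both sides are empty.\<close>

lemma sum_discrete_interval:
  "(\<Sum>t\<in>discrete_interval (a + real i) (a + real n). f t) = (\<Sum>k=i..n. f (a + real k))"
proof (rule sum.reindex_cong)
  show "inj_on (\<lambda>k. a + real k) {i..n}"
    by (simp add: inj_on_def)
  show "discrete_interval (a + real i) (a + real n) = (\<lambda>k. a + real k) ` {i..n}"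
  proof (intro set_eqI iffI)
    fix t assume "t \<in> discrete_interval (a + real i) (a + real n)"
    then obtain k where "t = a + real (i + k)" "i + k \<le> n"
      by (auto simp: discrete_interval_def add.assoc simp flip: of_nat_add)
    then show "t \<in> (\<lambda>k. a + real k) ` {i..n}"
      by (intro image_eqI[of _ _ "i + k"]) auto
  next
    fix t assume "t \<in> (\<lambda>k. a + real k) ` {i..n}"
    then obtain k where "t = a + real i + real (k - i)" "i \<le> k" "k \<le> n"
      by (auto simp: of_nat_diff)
    then show "t \<in> discrete_interval (a + real i) (a + real n)"
      unfolding discrete_interval_def by (intro CollectI exI[of _ "k - i"]) (auto simp: of_nat_diff)
  qed
qed simp

lemma sum_by_parts:
  fixes f g :: "nat \<Rightarrow> 'a::comm_ring"
  shows "(\<Sum>j=1..n. (f j - f (j - 1)) * g j) =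
    f n * g n - f 0 * g 0 - (\<Sum>j<n. f j * (g (Suc j) - g j))"
  by (induction n) (simp_all add: algebra_simps)

lemma right_ABR_eq_right_E1:
  "right_ABR B \<alpha> b f t =
    of_real (B \<alpha> / (1 - \<alpha>)) * (right_E1 \<alpha> b f t - right_E1 \<alpha> b f (t + 1))"
  unfolding right_ABR_def right_E1_def delta_diff_def by (simp add: algebra_simps)

text \<open>Green-type identity with arbitrary \<open>f\<close>. Its boundary terms contain
  \<open>right_E1\<close> at exactly the two points of the boundary conditions; taking
  \<open>p\<close> times a right difference for \<open>f\<close> makes the remaining sum
  symmetric.\<close>

lemma sum_left_ABC_mult:
  fixes a \<alpha> :: real and B :: "real \<Rightarrow> real" and n :: nat
  defines "b \<equiv> a + real n + 1" and "C \<equiv> complex_of_real (B \<alpha> / (1 - \<alpha>))"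
  shows "(\<Sum>i=1..n. left_ABC B \<alpha> a f (a + real i) * z (a + real i)) =
    C * f (b - 1) * right_E1 \<alpha> b z (b - 1) - C * f a * right_E1 \<alpha> b z a
      + (\<Sum>j<n. f (a + real j) * right_ABR B \<alpha> b z (a + real j))"
proof -
  \<comment> \<open>Both operators share a convolution kernel: for \<open>t = a + i\<close> and
    \<open>s = a + j\<close> with \<open>j\<close> \<le> \<open>i\<close>, \<open>t - rho s\<close>
    is \<open>(i - j) + 1\<close>, so truncated subtraction is exact.\<close>
  define e where "e k = complex_of_real (nabla_mittag_leffler \<alpha> (- \<alpha> / (1 - \<alpha>)) (real k + 1))"
    for k
  define F where "F j = f (a + real j)" for j
  define S where "S j = right_E1 \<alpha> b z (a + real j)" for j
  have b: "b - 1 = a + real n"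
    by (simp add: b_def)
  have left: "left_ABC B \<alpha> a f (a + real i) = C * (\<Sum>j=1..i. (F j - F (j - 1)) * e (i - j))" for i
  proof -
    have "left_ABC B \<alpha> a f (a + real i) = C * (\<Sum>j=1..i. nabla_diff f (a + real j) *
        of_real (nabla_mittag_leffler \<alpha> (- \<alpha> / (1 - \<alpha>)) (a + real i - rho (a + real j))))"
      unfolding left_ABC_def C_def by (simp add: sum_discrete_interval[of _ a 1 i, simplified])
    also have "\<dots> = C * (\<Sum>j=1..i. (F j - F (j - 1)) * e (i - j))"
      by (intro arg_cong[where f = "(*) C"] sum.cong refl)
        (auto simp: nabla_diff_def F_def e_def rho_def of_nat_diff algebra_simps)
    finally show ?thesis .
  qed
  have right: "S j = (\<Sum>i=j..n. e (i - j) * z (a + real i))" for j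
    unfolding S_def right_E1_def b sum_discrete_interval
    by (intro sum.cong refl) (auto simp: e_def rho_def of_nat_diff algebra_simps)
  have ABR: "right_ABR B \<alpha> b z (a + real j) = C * (S j - S (Suc j))" for j
    unfolding right_ABR_eq_right_E1 S_def C_def by (simp add: algebra_simps)
  have "(\<Sum>i=1..n. left_ABC B \<alpha> a f (a + real i) * z (a + real i)) =
      (\<Sum>i=1..n. \<Sum>j=1..i. C * ((F j - F (j - 1)) * (e (i - j) * z (a + real i))))"
    by (simp add: left sum_distrib_left sum_distrib_right mult.assoc)
  \<comment> \<open>Both double sums run over the triangle 1 \<le> \<open>j\<close> \<le>
    \<open>i\<close> \<le> \<open>n\<close>; fixing \<open>j\<close> first collects the kernel sum
    \<open>S j\<close>.\<close>
  also have "\<dots> = (\<Sum>j=1..n. \<Sum>i=j..n. C * ((F j - F (j - 1)) * (e (i - j) * z (a + real i))))"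
    by (simp add: sum.Sigma, rule sum.reindex_bij_witness[of _ prod.swap prod.swap]) auto
  also have "\<dots> = C * (\<Sum>j=1..n. (F j - F (j - 1)) * S j)"
    by (simp add: right sum_distrib_left)
  also have "\<dots> = C * F n * S n - C * F 0 * S 0 + (\<Sum>j<n. F j * (C * (S j - S (Suc j))))"
    unfolding sum_by_parts by (simp add: algebra_simps sum_distrib_left sum_subtractf)
  finally show ?thesis
    by (simp add: ABR F_def S_def b)
qed

text \<open>Eliminating either unknown shows that \<open>c\<close> and \<open>d\<close> both
  annihilate the determinant, and one of them is cancellable.\<close>

lemma two_by_two_det_eq_0:
  fixes c d x y u v :: "'a::idom"
  assumes "c \<noteq> 0 \<or> d \<noteq> 0" "c * x + d * y = 0" "c * u + d * v = 0"
  shows "y * u = v * x"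
proof -
  have "c * (y * u - v * x) = y * (c * u + d * v) - v * (c * x + d * y)"
    "d * (y * u - v * x) = u * (c * x + d * y) - x * (c * u + d * v)"
    by (simp_all add: algebra_simps)
  then show ?thesis
    using assms by auto
qed

theorem theorem14:
  fixes a b \<alpha> c1 c2 d1 d2 :: real
    and B p q r :: "real \<Rightarrow> real"
    and \<mu>1 \<mu>2 :: complex
    and x1 x2 :: "real \<Rightarrow> complex"
  assumes "b - a \<in> \<nat>" and "b - a > 0"
    and "0 < \<alpha>" and "\<alpha> < 1 / 2"
    and "B \<alpha> > 0"
    and "\<forall>t\<in>discrete_interval a (b - 1). p t \<noteq> 0 \<and> r t > 0"
    and "c1\<^sup>2 + c2\<^sup>2 \<noteq> 0" and "d1\<^sup>2 + d2\<^sup>2 \<noteq> 0"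
    and "SL_eigenvalue B \<alpha> a b p q r c1 c2 d1 d2 \<mu>1"
    and "SL_eigenvalue B \<alpha> a b p q r c1 c2 d1 d2 \<mu>2"
    and "\<mu>1 \<noteq> \<mu>2"
    and "SL_eigenfunction B \<alpha> a b p q r c1 c2 d1 d2 \<mu>1 x1"
    and "SL_eigenfunction B \<alpha> a b p q r c1 c2 d1 d2 \<mu>2 x2"
  shows "(\<Sum>t\<in>discrete_interval (a + 1) (b - 1). of_real (r t) * x1 t * x2 t) = 0"
proof -
  from \<open>b - a \<in> \<nat>\<close> obtain m where "b - a = real m"
    by (auto elim: Nats_cases)
  \<comment> \<open>Here \<open>n\<close> is \<open>b - a - 1\<close>, so \<open>b - 1\<close> is
    \<open>a + n\<close> and the equation is posed at the indices 1 to \<open>n\<close>.\<close>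
  with \<open>b - a > 0\<close> obtain n where "b - a = real (Suc n)"
    by (cases m) auto
  then have b: "b = a + real n + 1"
    by simp
  define C where "C = complex_of_real (B \<alpha> / (1 - \<alpha>))"
  define D where "D x t = right_ABR B \<alpha> b x t" for x t
  define L where "L x t = left_ABC B \<alpha> a (\<lambda>s. of_real (p s) * D x s) t" for x t
  have interval: "(\<Sum>t\<in>discrete_interval (a + 1) (b - 1). g t) = (\<Sum>i=1..n. g (a + real i))"
    for g :: "real \<Rightarrow> complex"
    using sum_discrete_interval[of g a 1 n] by (simp add: b)
  have mem: "a + real i \<in> discrete_interval (a + 1) (b - 1)" if "i \<in> {1..n}" for i
    using that unfolding discrete_interval_def b
    by (intro CollectI exI[of _ "i - 1"]) (auto simp: of_nat_diff)
  have sol1: "SL_solution B \<alpha> a b p q r c1 c2 d1 d2 \<mu>1 x1"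
    and sol2: "SL_solution B \<alpha> a b p q r c1 c2 d1 d2 \<mu>2 x2"
    using assms(12,13) by (auto simp: SL_eigenfunction_def)
  have eq1: "L x1 (a + real i) = (\<mu>1 * of_real (r (a + real i)) - of_real (q (a + real i))) * x1 (a + real i)"
    and eq2: "L x2 (a + real i) = (\<mu>2 * of_real (r (a + real i)) - of_real (q (a + real i))) * x2 (a + real i)"
    if "i \<in> {1..n}" for i
    using sol1 sol2 mem[OF that] by (auto simp: SL_solution_def L_def D_def algebra_simps)
  have det_a: "D x1 a * right_E1 \<alpha> b x2 a = D x2 a * right_E1 \<alpha> b x1 a"
    using sol1 sol2 assms(7)
    by (intro two_by_two_det_eq_0[of "of_real c1" "of_real c2"]) (auto simp: SL_solution_def D_def)
  have det_b: "D x1 (b - 1) * right_E1 \<alpha> b x2 (b - 1) = D x2 (b - 1) * right_E1 \<alpha> b x1 (b - 1)"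
    using sol1 sol2 assms(8)
    by (intro two_by_two_det_eq_0[of "of_real d1" "of_real d2"]) (auto simp: SL_solution_def D_def)
  have green: "(\<Sum>i=1..n. L x (a + real i) * z (a + real i)) =
      C * of_real (p (b - 1)) * (D x (b - 1) * right_E1 \<alpha> b z (b - 1))
      - C * of_real (p a) * (D x a * right_E1 \<alpha> b z a)
      + (\<Sum>j<n. of_real (p (a + real j)) * (D x (a + real j) * D z (a + real j)))" for x z
    unfolding L_def D_def C_def b sum_left_ABC_mult by (simp add: mult.assoc)
  \<comment> \<open>The determinant identities turn the boundary terms of \<open>(x1, x2)\<close>
    into those of \<open>(x2, x1)\<close>; the remaining sum is symmetric by commutativity.\<close>
  have "(\<Sum>i=1..n. L x1 (a + real i) * x2 (a + real i)) =
      (\<Sum>i=1..n. L x2 (a + real i) * x1 (a + real i))"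
    unfolding green det_a det_b by (simp add: mult.commute)
  then have "0 = (\<Sum>i=1..n. L x1 (a + real i) * x2 (a + real i) - L x2 (a + real i) * x1 (a + real i))"
    by (simp add: sum_subtractf)
  \<comment> \<open>The \<open>q\<close> terms cancel. Since no conjugation occurs, the factor is
    \<mu>1 - \<mu>2 even for complex eigenvalues.\<close>
  also have "\<dots> = (\<mu>1 - \<mu>2) * (\<Sum>i=1..n. of_real (r (a + real i)) * x1 (a + real i) * x2 (a + real i))"
    unfolding sum_distrib_left by (intro sum.cong refl) (simp only: eq1 eq2, simp add: algebra_simps)
  finally show ?thesis
    using \<open>\<mu>1 \<noteq> \<mu>2\<close> by (simp add: interval)
qed

end
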